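(* Let $d\ge2$. There are copulas $C\in\mathcal{C}_{ar}^d$ with the following property: there is some Borel set $\Lambda\subseteq\mathbb{I}^{d-1}$ with $\lambda_{d-1}(\Lambda)=1$ such that for every $\mathbf{x}\in\Lambda$ the partial derivative $\partial_1\cdots\partial_{d-1}C(\mathbf{x},y)$ does not exist for a dense set of $y\in\mathbb{I}$. The same result still holds for any ordering of the mixed partial derivatives of order $d-1$, i.e. with $\partial_1\cdots\partial_{d-1}$ replaced by $\partial_{\pi(1)}\cdots\partial_{\pi(d-1)}$ for any permutation $\pi$ of $\{1,\dots,d-1\}$.
   Context: $\mathbb{I}=[0,1]$; $\lambda_{d-1}$ is Lebesgue measure on $\mathbb{I}^{d-1}$. Points of $\mathbb{I}^d$ are written $(\mathbf{x},y)$ with $\mathbf{x}=(x_1,\dots,x_{d-1})\in\mathbb{I}^{d-1}$, $y\in\mathbb{I}$; $\partial_i$ denotes the partial derivative in the $i$-th coordinate, and $\partial_1\cdots\partial_{d-1}C=\partial_1(\partial_2(\cdots\partial_{d-1}C))$. A generator is a continuous non-increasing $\psi:[0,\infty)\to\mathbb{I}$ with $\psi(0)=1$, $\psi(\infty):=\lim_{z\to\infty}\psi(z)=0$, strictly decreasing on $[0,\inf\{x:\psi(x)=0\})$ (with $\inf\emptyset=\infty$); its pseudo-inverse is $\varphi(y)=\inf\{z\in[0,\infty]:\psi(z)=y\}$, $y\in\mathbb{I}$. $\mathcal{C}_{ar}^d$ is the set of $d$-dimensional Archimedean copulas, i.e. copulas of the form $C(\mathbf{u})=\psi(\sum_{i=1}^d\varphi(u_i))$,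 $\mathbf{u}\in\mathbb{I}^d$ (this function is a copula iff $\psi$ is $d$-monotone, i.e., with $\psi$ continuous on $[0,\infty)$, on $(0,\infty)$ $\psi$ is differentiable up to order $d-2$, $(-1)^k\psi^{(k)}\ge0$ for $k\le d-2$, and $(-1)^{d-2}\psi^{(d-2)}$ is non-increasing and convex). *)

theory Defs
  imports "HOL-Analysis.Analysis" "HOL-Combinatorics.Permutations"
begin

text \<open>Points of the cube with coordinates indexed by a finite set \<open>I\<close> of naturals are extensional
  functions. With \<open>I = {1..d}\<close> this is the domain of a \<open>d\<close>-dimensional copula, with
  \<open>I = {1..<d}\<close> it is the space of the first \<open>d - 1\<close> coordinates; the point \<open>(x, y)\<close> is
  \<open>x(d := y)\<close>.\<close>

definition unit_cube :: "nat set \<Rightarrow> (nat \<Rightarrow> real) set" where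
  "unit_cube I = I \<rightarrow>\<^sub>E {0..1}"

text \<open>The last condition says that every box \<open>[a, b]\<close> has nonnegative \<open>C\<close>-volume; \<open>S\<close> is the
  set of coordinates in which the lower corner is taken.\<close>

definition copula :: "nat \<Rightarrow> ((nat \<Rightarrow> real) \<Rightarrow> real) \<Rightarrow> bool" where
  "copula d C \<longleftrightarrow>
     (\<forall>u\<in>unit_cube {1..d}. (\<exists>i\<in>{1..d}. u i = 0) \<longrightarrow> C u = 0) \<and>
     (\<forall>u\<in>unit_cube {1..d}. \<forall>i\<in>{1..d}. (\<forall>j\<in>{1..d} - {i}. u j = 1) \<longrightarrow> C u = u i) \<and>
     (\<forall>a\<in>unit_cube {1..d}. \<forall>b\<in>unit_cube {1..d}. (\<forall>i\<in>{1..d}. a i \<le> b i) \<longrightarrow>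
        (\<Sum>S\<in>Pow {1..d}. (- 1) ^ card S * C (\<lambda>i. if i \<in> S then a i else b i)) \<ge> 0)"

text \<open>Only the values of \<open>\<psi>\<close> on \<open>[0, \<infinity>)\<close> matter. The infimum is taken in \<open>[0, \<infinity>]\<close>, so that
  it is \<open>\<infinity>\<close> for the empty set.\<close>

definition generator :: "(real \<Rightarrow> real) \<Rightarrow> bool" where
  "generator \<psi> \<longleftrightarrow>
     continuous_on {0..} \<psi> \<and> antimono_on {0..} \<psi> \<and> \<psi> \<in> {0..} \<rightarrow> {0..1} \<and>
     \<psi> 0 = 1 \<and> (\<psi> \<longlongrightarrow> 0) at_top \<and>
     strict_antimono_on {z. 0 \<le> z \<and> ennreal z < Inf (ennreal ` {x. 0 \<le> x \<and> \<psi> x = 0})} \<psi>"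

text \<open>The extension to \<open>[0, \<infinity>]\<close> by \<open>\<psi>(\<infinity>) = lim\<^bsub>z \<rightarrow> \<infinity>\<^esub> \<psi>(z)\<close>, which is \<open>0\<close> for
  every generator.\<close>

definition generator_ext :: "(real \<Rightarrow> real) \<Rightarrow> ennreal \<Rightarrow> real" where
  "generator_ext \<psi> z = (if z = \<infinity> then 0 else \<psi> (enn2real z))"

definition pseudo_inverse :: "(real \<Rightarrow> real) \<Rightarrow> real \<Rightarrow> ennreal" where
  "pseudo_inverse \<psi> y = Inf {z. generator_ext \<psi> z = y}"

definition archimedean_copula :: "nat \<Rightarrow> ((nat \<Rightarrow> real) \<Rightarrow> real) \<Rightarrow> bool" where
  "archimedean_copula d C \<longleftrightarrow> copula d C \<and>
     (\<exists>\<psi>. generator \<psi> \<and>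
        (\<forall>u\<in>unit_cube {1..d}. C u = generator_ext \<psi> (\<Sum>i=1..d. pseudo_inverse \<psi> (u i))))"

text \<open>\<open>has_mixed_partial [i\<^sub>1, \<dots>, i\<^sub>k] f u D\<close>: the iterated partial derivative
  \<open>\<partial>\<^bsub>i\<^sub>1\<^esub>(\<partial>\<^bsub>i\<^sub>2\<^esub>(\<dots>\<partial>\<^bsub>i\<^sub>k\<^esub> f))\<close> of a function \<open>f\<close> on the unit cube exists at \<open>u\<close> and equals
  \<open>D\<close>. The inner derivative \<open>g\<close> has to exist only near \<open>u\<close> along the \<open>i\<^sub>1\<close>-th coordinate
  direction; derivatives at boundary points of the cube are one-sided.\<close>

primrec has_mixed_partial ::
  "nat list \<Rightarrow> ((nat \<Rightarrow> real) \<Rightarrow> real) \<Rightarrow> (nat \<Rightarrow> real) \<Rightarrow> real \<Rightarrow> bool" where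
  "has_mixed_partial [] f u D \<longleftrightarrow> D = f u"
| "has_mixed_partial (i # ks) f u D \<longleftrightarrow>
     (\<exists>g. (\<exists>e>0. \<forall>t\<in>{0..1}. \<bar>t - u i\<bar> < e \<longrightarrow> has_mixed_partial ks f (u(i := t)) (g t)) \<and>
          (g has_real_derivative D) (at (u i) within {0..1}))"

end

theory Submission
  imports Defs
begin

text \<open>Take for \<open>\<psi>\<close> a mixture, with positive summable weights, of the extremal \<open>d\<close>-monotone functions
  \<open>max 0 (q - z) ^ (d - 1)\<close> over all positive rationals \<open>q\<close>. Then \<open>\<psi>\<close> is a strict generator whose
  derivative of order \<open>d - 2\<close> is a mixture of the functions \<open>max 0 (q - z)\<close> and hence has a kink at
  every positive rational. Where it exists, the mixed partial derivative of order \<open>d - 2\<close> of the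
  copula is this derivative at \<open>\<Sum>i. \<phi> (u i)\<close>, divided by a nonzero product. So for given \<open>x\<close> the last
  differentiation fails whenever \<open>\<phi> (x 1) + \<dots> + \<phi> (x (d - 1)) + \<phi> y\<close> is rational, which happens for
  a dense set of \<open>y\<close>. Only the countably many coordinate values \<open>x i\<close> with \<open>\<phi> (x i)\<close> rational have
  to be avoided.\<close>

section \<open>Termwise differentiation and truncated powers\<close>

text \<open>The difference quotients at \<open>z\<close> are dominated by the summable
  \<open>M\<close>, so Tannery's theorem exchanges limit and sum. Derivatives of the terms are asked
  for at \<open>z\<close> only, because the terms used later have kinks arbitrarily close to
  \<open>z\<close>.\<close>

lemma DERIV_suminf_Lipschitz:
  fixes f :: "nat \<Rightarrow> real \<Rightarrow> real"
  assumes U: "open U" "z \<in> U"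
    and deriv: "\<And>n. (f n has_real_derivative f' n) (at z)"
    and lipschitz: "\<And>n w. w \<in> U \<Longrightarrow> \<bar>f n w - f n z\<bar> \<le> M n * \<bar>w - z\<bar>"
    and "summable M"
    and summable_f: "\<And>w. w \<in> U \<Longrightarrow> summable (\<lambda>n. f n w)"
  shows "((\<lambda>w. \<Sum>n. f n w) has_real_derivative (\<Sum>n. f' n)) (at z)"
proof -
  have ev_U: "eventually (\<lambda>w. w \<in> U \<and> w \<noteq> z) (at z)"
    using eventually_at_in_open[OF U] by (rule eventually_mono) auto
  have "eventually (\<lambda>w. \<forall>n. norm ((f n w - f n z) / (w - z)) \<le> M n) (at z)"
    using ev_U
  proof eventually_elim
    case (elim w)
    then show ?case using lipschitz[of w] by (simp add: field_simps)
  qed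
  from eventually_prodI[OF eventually_True[of at_top] this]
  have bound: "eventually (\<lambda>(n, w). norm ((f n w - f n z) / (w - z)) \<le> M n) (at_top \<times>\<^sub>F at z)"
    by (rule eventually_mono) auto
  have "((\<lambda>w. \<Sum>n. (f n w - f n z) / (w - z)) \<longlongrightarrow> (\<Sum>n. f' n)) (at z)"
    using tannerys_theorem[OF _ bound \<open>summable M\<close>] deriv
    by (auto simp: has_field_derivative_iff)
  moreover have "eventually (\<lambda>w. (\<Sum>n. (f n w - f n z) / (w - z)) =
      ((\<Sum>n. f n w) - (\<Sum>n. f n z)) / (w - z)) (at z)"
    using ev_U
  proof eventually_elim
    case (elim w)
    then show ?case
      using summable_f U by (simp add: suminf_divide summable_diff suminf_diff)
  qed
  ultimately show ?thesis
    unfolding has_field_derivative_iff using tendsto_cong by fast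
qed

text \<open>For \<open>k = 0\<close> this is an indicator function, not the constant \<open>1\<close> that \<open>max 0 t ^ 0\<close> is;
  this makes the derivative formula below hold for \<open>k = 0\<close>.\<close>

definition truncated_power :: "nat \<Rightarrow> real \<Rightarrow> real" where
  "truncated_power k t = (if t > 0 then t ^ k else 0)"

lemma truncated_power_nonneg: "0 \<le> truncated_power k t"
  by (simp add: truncated_power_def)

lemma truncated_power_le: "t \<le> s \<Longrightarrow> 0 \<le> s \<Longrightarrow> truncated_power k t \<le> s ^ k"
  by (auto simp: truncated_power_def power_mono)

lemma truncated_power_mono: "t \<le> s \<Longrightarrow> truncated_power k t \<le> truncated_power k s"
  by (auto simp: truncated_power_def power_mono)

text \<open>With \<open>x = max 0 t\<close> and \<open>y = max 0 s\<close>, factoring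
  \<open>x ^ Suc k - y ^ Suc k\<close> leaves \<open>Suc k\<close> summands of size at most
  \<open>B ^ k\<close>, and \<open>max 0\<close> does not increase distances.\<close>

lemma truncated_power_lipschitz:
  assumes "t \<le> B" "s \<le> B" "0 \<le> B"
  shows "\<bar>truncated_power (Suc k) t - truncated_power (Suc k) s\<bar> \<le> real (Suc k) * B ^ k * \<bar>t - s\<bar>"
proof -
  define x y where "x = max 0 t" and "y = max 0 s"
  have bnd: "0 \<le> x" "x \<le> B" "0 \<le> y" "y \<le> B"
    using assms by (auto simp: x_def y_def)
  have "(\<Sum>p<Suc k. x ^ p * y ^ (k - p)) \<le> (\<Sum>p<Suc k. B ^ k)"
  proof (rule sum_mono)
    fix p assume "p \<in> {..<Suc k}"
    have "x ^ p * y ^ (k - p) \<le> B ^ p * B ^ (k - p)"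
      using bnd by (intro mult_mono power_mono) auto
    also have "\<dots> = B ^ k"
      using \<open>p \<in> {..<Suc k}\<close> by (simp flip: power_add)
    finally show "x ^ p * y ^ (k - p) \<le> B ^ k" .
  qed
  moreover have "0 \<le> (\<Sum>p<Suc k. x ^ p * y ^ (k - p))"
    using bnd by (intro sum_nonneg) auto
  ultimately have sum: "\<bar>\<Sum>p<Suc k. x ^ p * y ^ (k - p)\<bar> \<le> real (Suc k) * B ^ k"
    by simp
  have "truncated_power (Suc k) t - truncated_power (Suc k) s = x ^ Suc k - y ^ Suc k"
    by (simp add: truncated_power_def x_def y_def max_def)
  also have "\<bar>\<dots>\<bar> = \<bar>x - y\<bar> * \<bar>\<Sum>p<Suc k. x ^ p * y ^ (k - p)\<bar>"
    by (simp only: diff_power_eq_sum abs_mult)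
  also have "\<dots> \<le> \<bar>t - s\<bar> * (real (Suc k) * B ^ k)"
  proof (rule mult_mono[OF _ sum])
    show "\<bar>x - y\<bar> \<le> \<bar>t - s\<bar>"
      by (auto simp: x_def y_def max_def)
  qed auto
  finally show ?thesis by (simp add: mult_ac)
qed

lemma DERIV_truncated_power:
  assumes "k \<ge> 1 \<or> t \<noteq> 0"
  shows "(truncated_power (Suc k) has_real_derivative real (Suc k) * truncated_power k t) (at t)"
proof -
  consider "t > 0" | "t < 0" | "t = 0" "k \<ge> 1"
    using assms by linarith
  then show ?thesis
  proof cases
    case 1
    have "((\<lambda>t. t ^ Suc k) has_real_derivative real (Suc k) * t ^ k) (at t)"
      using DERIV_pow[of "Suc k" t] by simp
    then have "(truncated_power (Suc k) has_real_derivative real (Suc k) * t ^ k) (at t)"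
      by (rule has_field_derivative_transform_within_open[where S = "{0<..}"])
         (use 1 in \<open>auto simp: truncated_power_def\<close>)
    then show ?thesis using 1 by (simp add: truncated_power_def)
  next
    case 2
    have "((\<lambda>t. 0) has_real_derivative 0) (at t)"
      by simp
    then have "(truncated_power (Suc k) has_real_derivative 0) (at t)"
      by (rule has_field_derivative_transform_within_open[where S = "{..<0}"])
         (use 2 in \<open>auto simp: truncated_power_def\<close>)
    then show ?thesis using 2 by (simp add: truncated_power_def)
  next
    case 3
    \<comment> \<open>At the junction the difference quotient is bounded by
      \<open>\<bar>h\<bar> ^ k\<close>, which tends to 0 because \<open>k \<ge> 1\<close>.\<close>
    have "((\<lambda>h::real. \<bar>h\<bar> ^ k) \<longlongrightarrow> 0) (at 0)"
      using 3 by (auto intro!: tendsto_eq_intros)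
    then have "((\<lambda>h. truncated_power (Suc k) h / h) \<longlongrightarrow> 0) (at 0)"
      by (rule Lim_null_comparison[rotated]) (auto simp: truncated_power_def)
    then show ?thesis
      using 3 by (simp add: has_field_derivative_iff truncated_power_def)
  qed
qed

lemma not_DERIV_truncated_power_1:
  "\<not> (truncated_power 1 has_real_derivative D) (at 0)"
proof
  assume "(truncated_power 1 has_real_derivative D) (at 0)"
  then have lim: "((\<lambda>h. truncated_power 1 h / h) \<longlongrightarrow> D) (at 0)"
    by (simp add: has_field_derivative_iff truncated_power_def)
  have "((\<lambda>h. truncated_power 1 h / h) \<longlongrightarrow> 1) (at_right 0)"
    by (rule tendsto_eventually) (auto simp: truncated_power_def eventually_at_filter)
  then have "D = 1"
    using lim by (intro tendsto_unique[OF trivial_limit_at_right_real])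
      (auto simp: filterlim_at_split)
  moreover have "((\<lambda>h. truncated_power 1 h / h) \<longlongrightarrow> 0) (at_left 0)"
    by (rule tendsto_eventually) (auto simp: truncated_power_def eventually_at_filter)
  then have "D = 0"
    using lim by (intro tendsto_unique[OF trivial_limit_at_left_real])
      (auto simp: filterlim_at_split)
  ultimately show False by simp
qed

text \<open>With alternating signs the two halves form a difference in direction \<open>i\<close>;
  this reduces volumes to fewer coordinates.\<close>

lemma sum_Pow_insert:
  fixes F :: "'a set \<Rightarrow> 'b::comm_monoid_add"
  assumes "finite J" "i \<notin> J"
  shows "(\<Sum>S\<in>Pow (insert i J). F S) = (\<Sum>S\<in>Pow J. F S) + (\<Sum>S\<in>Pow J. F (insert i S))"
proof -
  have "inj_on (insert i) (Pow J)"
    using assms by (auto simp: inj_on_def insert_ident)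
  then have "sum F (insert i ` Pow J) = (\<Sum>S\<in>Pow J. F (insert i S))"
    by (simp add: sum.reindex)
  moreover have "Pow J \<inter> insert i ` Pow J = {}"
    using assms by auto
  ultimately show ?thesis
    using assms by (simp add: Pow_insert sum.union_disjoint)
qed

section \<open>Mixtures of truncated powers\<close>

text \<open>The weights of truncated powers; the bound makes the series and all its termwise
  derivatives up to order \<open>K\<close> converge uniformly on \<open>[-1, \<infinity>)\<close>. The domain is larger than
  \<open>[0, \<infinity>)\<close> so that \<open>0\<close> is an interior point.\<close>

locale truncated_power_series =
  fixes a c :: "nat \<Rightarrow> real" and K :: nat
  assumes a_pos: "\<And>n. 0 < a n"
    and c_nonneg: "\<And>n. 0 \<le> c n"
    and c_le: "\<And>n. c n \<le> (1/2) ^ n / (1 + a n) ^ K"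
begin

definition series :: "nat \<Rightarrow> real \<Rightarrow> real" where
  "series k z = (\<Sum>n. c n * truncated_power k (a n - z))"

lemma c_power_le:
  assumes "k \<le> K"
  shows "c n * (1 + a n) ^ k \<le> (1/2) ^ n"
proof -
  have "c n * (1 + a n) ^ k \<le> c n * (1 + a n) ^ K"
    using assms a_pos[of n] by (intro mult_left_mono power_increasing c_nonneg) auto
  also have "\<dots> \<le> (1/2) ^ n"
    using c_le[of n] a_pos[of n] by (simp add: field_simps)
  finally show ?thesis .
qed

lemma term_nonneg: "0 \<le> c n * truncated_power k (a n - z)"
  by (simp add: c_nonneg truncated_power_nonneg)

lemma term_le:
  assumes "k \<le> K" "-1 \<le> z"
  shows "c n * truncated_power k (a n - z) \<le> (1/2) ^ n"
proof -
  have "c n * truncated_power k (a n - z) \<le> c n * (1 + a n) ^ k"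
    using assms a_pos[of n] by (intro mult_left_mono truncated_power_le c_nonneg) auto
  with c_power_le[OF assms(1)] show ?thesis by (rule order_trans[rotated])
qed

lemma summable_terms:
  assumes "k \<le> K" "-1 \<le> z"
  shows "summable (\<lambda>n. c n * truncated_power k (a n - z))"
  by (rule summable_comparison_test'[of "\<lambda>n. (1/2) ^ n" 0])
     (use term_le[OF assms] term_nonneg in \<open>auto simp: summable_geometric abs_of_nonneg\<close>)

lemma series_nonneg: "k \<le> K \<Longrightarrow> -1 \<le> z \<Longrightarrow> 0 \<le> series k z"
  unfolding series_def by (intro suminf_nonneg summable_terms term_nonneg)

lemma continuous_on_series:
  assumes "1 \<le> k" "k \<le> K"
  shows "continuous_on {-1..} (series k)"
  unfolding series_def
proof (rule uniform_limit_theorem)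
  show "uniform_limit {-1..} (\<lambda>N z. \<Sum>n<N. c n * truncated_power k (a n - z))
      (\<lambda>z. \<Sum>n. c n * truncated_power k (a n - z)) sequentially"
    using term_le[OF assms(2)] term_nonneg
    by (intro Weierstrass_m_test[of _ _ "\<lambda>n. (1/2) ^ n"])
       (auto simp: summable_geometric abs_of_nonneg)
  have "truncated_power k = (\<lambda>t. max 0 t ^ k)"
    using assms by (auto simp: truncated_power_def fun_eq_iff max_def)
  then show "\<forall>\<^sub>F N in sequentially.
      continuous_on {-1..} (\<lambda>z. \<Sum>n<N. c n * truncated_power k (a n - z))"
    by (auto intro!: always_eventually continuous_intros)
qed simp

lemma series_tendsto_0:
  assumes "k \<le> K"
  shows "(series k \<longlongrightarrow> 0) at_top"
proof -
  have "eventually (\<lambda>z::real. -1 \<le> z) at_top" by (rule eventually_ge_at_top)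
  then have "eventually (\<lambda>z. \<forall>n. norm (c n * truncated_power k (a n - z)) \<le> (1/2) ^ n) at_top"
    by eventually_elim (use term_le[OF assms] term_nonneg in \<open>auto simp: abs_of_nonneg\<close>)
  from eventually_prodI[OF eventually_True[of at_top] this]
  have bound: "eventually (\<lambda>(n, z). norm (c n * truncated_power k (a n - z)) \<le> (1/2) ^ n)
      (at_top \<times>\<^sub>F at_top)"
    by (rule eventually_mono) auto
  have "((\<lambda>z. c n * truncated_power k (a n - z)) \<longlongrightarrow> 0) at_top" for n
    by (intro tendsto_eventually eventually_mono[OF eventually_ge_at_top[of "a n"]])
       (simp add: truncated_power_def)
  from tannerys_theorem[OF this bound]
  have "((\<lambda>z. \<Sum>n. c n * truncated_power k (a n - z)) \<longlongrightarrow> (\<Sum>n::nat. 0)) at_top"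
    by (simp add: summable_geometric)
  then show ?thesis by (simp add: series_def[abs_def])
qed

text \<open>Termwise differentiation under the summable Lipschitz bound. For \<open>k = 0\<close>
  the term with index \<open>n\<close> has a kink at \<open>a n\<close>; asking only for weight zero
  there lets the lemma apply once the offending weights have been set to 0.\<close>

lemma DERIV_series:
  assumes "Suc k \<le> K" "-1 < z" and "k \<ge> 1 \<or> (\<forall>n. a n = z \<longrightarrow> c n = 0)"
  shows "(series (Suc k) has_real_derivative - real (Suc k) * series k z) (at z)"
proof -
  define f' where "f' n = - real (Suc k) * (c n * truncated_power k (a n - z))" for n
  have "((\<lambda>w. \<Sum>n. c n * truncated_power (Suc k) (a n - w)) has_real_derivative (\<Sum>n. f' n)) (at z)"
  proof (rule DERIV_suminf_Lipschitz[where U = "{-1<..}" and M = "\<lambda>n. real (Suc k) * (1/2) ^ n"])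
    fix n
    show "((\<lambda>w. c n * truncated_power (Suc k) (a n - w)) has_real_derivative f' n) (at z)"
    proof (cases "c n = 0")
      case False
      then have "k \<ge> 1 \<or> a n - z \<noteq> 0" using assms(3) by auto
      then have "((\<lambda>w. truncated_power (Suc k) (a n - w)) has_real_derivative
          real (Suc k) * truncated_power k (a n - z) * - 1) (at z)"
        by (intro DERIV_chain2[where g = "\<lambda>w. a n - w"] DERIV_truncated_power)
           (auto intro!: derivative_eq_intros)
      from DERIV_cmult[OF this, of "c n"] show ?thesis
        by (simp add: f'_def algebra_simps)
    qed (simp add: f'_def)
    fix w :: real assume w: "w \<in> {-1<..}"
    have "\<bar>c n * truncated_power (Suc k) (a n - w) - c n * truncated_power (Suc k) (a n - z)\<bar>
        = c n * \<bar>truncated_power (Suc k) (a n - w) - truncated_power (Suc k) (a n - z)\<bar>"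
      using c_nonneg[of n] by (simp add: abs_mult flip: right_diff_distrib)
    \<comment> \<open>Both arguments lie below \<open>1 + a n\<close> because \<open>w\<close> and
      \<open>z\<close> exceed -1.\<close>
    also have "\<dots> \<le> c n * (real (Suc k) * (1 + a n) ^ k * \<bar>(a n - w) - (a n - z)\<bar>)"
      using a_pos[of n] w assms(2)
      by (intro mult_left_mono truncated_power_lipschitz c_nonneg) auto
    also have "\<dots> = real (Suc k) * (c n * (1 + a n) ^ k) * \<bar>w - z\<bar>"
      by (simp add: mult_ac abs_minus_commute)
    also have "\<dots> \<le> real (Suc k) * (1/2) ^ n * \<bar>w - z\<bar>"
      using assms(1) by (intro mult_mono mult_left_mono c_power_le) auto
    finally show "\<bar>c n * truncated_power (Suc k) (a n - w) - c n * truncated_power (Suc k) (a n - z)\<bar>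
        \<le> real (Suc k) * (1/2) ^ n * \<bar>w - z\<bar>" .
  qed (use assms summable_terms in \<open>auto intro!: summable_mult simp: summable_geometric\<close>)
  moreover have "(\<Sum>n. f' n) = - real (Suc k) * series k z"
    unfolding f'_def series_def using assms by (intro suminf_mult summable_terms) auto
  ultimately show ?thesis
    by (simp add: series_def[abs_def])
qed

lemma series_pos:
  assumes "k \<le> K" "-1 \<le> z" "z < a n" "0 < c n"
  shows "0 < series k z"
  unfolding series_def
  by (rule suminf_pos2[where i = n])
     (use assms summable_terms term_nonneg in \<open>auto simp: truncated_power_def\<close>)

lemma series_strict_antimono:
  assumes "1 \<le> k" "k \<le> K" "-1 \<le> z" "z < w" "z < a n" "0 < c n"
  shows "series k w < series k z"
proof -
  define f where "f n = c n * truncated_power k (a n - z) - c n * truncated_power k (a n - w)" for n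
  have "0 < (\<Sum>n. f n)"
  proof (rule suminf_pos2[where i = n])
    show "summable f"
      unfolding f_def using assms by (intro summable_diff summable_terms) auto
    show "0 \<le> f m" for m
      using assms c_nonneg[of m] unfolding f_def
      by (simp add: mult_left_mono truncated_power_mono)
    have "truncated_power k (a n - w) < truncated_power k (a n - z)"
      using assms by (auto simp: truncated_power_def intro!: power_strict_mono)
    then show "0 < f n"
      using assms by (simp add: f_def)
  qed
  also have "(\<Sum>n. f n) = series k z - series k w"
    unfolding f_def series_def using assms by (intro suminf_diff[symmetric] summable_terms) auto
  finally show ?thesis by simp
qed

lemma series_antimono:
  assumes "k \<le> K" "-1 \<le> z" "z \<le> w"
  shows "series k w \<le> series k z"
  unfolding series_def using assms
  by (intro suminf_le mult_left_mono truncated_power_mono c_nonneg summable_terms) auto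

text \<open>Holds termwise, since \<open>truncated_power 1\<close> is the convex function
  \<open>max 0\<close>. The second difference is the shape that convexity takes in an alternating
  sum over two coordinates.\<close>

lemma series_1_convex:
  assumes "1 \<le> K" "-1 \<le> z" "0 \<le> h" "0 \<le> h'"
  shows "series 1 (z + h) + series 1 (z + h') \<le> series 1 z + series 1 (z + h + h')"
proof -
  have summable: "summable (\<lambda>n. c n * truncated_power 1 (a n - w))" if "-1 \<le> w" for w
    using assms that by (intro summable_terms) auto
  have "c n * truncated_power 1 (a n - (z + h)) + c n * truncated_power 1 (a n - (z + h'))
      \<le> c n * truncated_power 1 (a n - z) + c n * truncated_power 1 (a n - (z + h + h'))" for n
    unfolding distrib_left[symmetric]
    by (intro mult_left_mono c_nonneg) (use assms in \<open>auto simp: truncated_power_def\<close>)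
  then show ?thesis
    unfolding series_def using assms
    by (subst (1 2) suminf_add) (auto intro!: suminf_le summable_add summable simp del: One_nat_def)
qed

text \<open>The source of nonnegative volumes. In the induction on \<open>k\<close> each
  differentiation removes one increment; at \<open>k = 1\<close> monotonicity and convexity deal
  with up to two increments without any derivative, whence the bound \<open>Suc k\<close>.\<close>

lemma series_alternating_sum_nonneg:
  assumes "1 \<le> k" "k \<le> K" "finite J" "card J \<le> Suc k" "\<And>i. i \<in> J \<Longrightarrow> 0 \<le> h i" "0 \<le> z"
  shows "0 \<le> (\<Sum>S\<in>Pow J. (- 1) ^ card S * series k (z + sum h S))"
  using assms
proof (induction k arbitrary: J z rule: dec_induct)
  case base
  from base.prems(2,3) consider "J = {}" | i where "J = {i}" | i j where "J = {i, j}" "i \<noteq> j"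
    by (metis One_nat_def Suc_1 card_0_eq card_1_singletonE card_2_iff le_SucE le_zero_eq)
  then show ?case
  proof cases
    case 1
    then show ?thesis using base series_nonneg[of 1 z] by simp
  next
    case 2
    then show ?thesis using base series_antimono[of 1 z "z + h i"]
      by (simp add: sum_Pow_insert)
  next
    case 3
    then show ?thesis using base series_1_convex[of z "h i" "h j"]
      by (simp add: sum_Pow_insert add_ac)
  qed
next
  case (step k)
  show ?case
  proof (cases "J = {}")
    case True
    then show ?thesis using step series_nonneg[of "Suc k" z] by simp
  next
    case False
    then obtain i J' where J: "J = insert i J'" "i \<notin> J'"
      by (meson all_not_in_conv mk_disjoint_insert)
    have fin: "finite J'" using J step.prems by auto
    have h: "0 \<le> sum h S" if "S \<subseteq> J'" for S
      using step.prems J that by (intro sum_nonneg) auto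
    \<comment> \<open>The whole sum is \<open>G z - G (z + h i)\<close>, and the derivative of
      \<open>G\<close> is \<open>- real (Suc k)\<close> times an alternating sum of order
      \<open>k\<close>, so \<open>G\<close> is non-increasing by the induction hypothesis.\<close>
    define G where "G w = (\<Sum>S\<in>Pow J'. (- 1) ^ card S * series (Suc k) (w + sum h S))" for w
    have "G (z + h i) \<le> G z"
    proof (rule DERIV_nonpos_imp_nonincreasing[where f = G and a = z and b = "z + h i"])
      show "z \<le> z + h i" using step.prems J by simp
      fix w assume w: "z \<le> w" "w \<le> z + h i"
      define G' where "G' = (\<Sum>S\<in>Pow J'. (- 1) ^ card S * (- real (Suc k) * series k (w + sum h S)))"
      have "(G has_real_derivative G') (at w)"
        unfolding G_def G'_def
      proof (intro DERIV_sum DERIV_cmult)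
        fix S assume "S \<in> Pow J'"
        then have "(series (Suc k) has_real_derivative - real (Suc k) * series k (w + sum h S))
            (at (w + sum h S))"
          using h[of S] w step by (intro DERIV_series) auto
        then show "((\<lambda>w. series (Suc k) (w + sum h S)) has_real_derivative
            - real (Suc k) * series k (w + sum h S)) (at w)"
          by (simp add: DERIV_shift)
      qed
      moreover have "G' = - real (Suc k) * (\<Sum>S\<in>Pow J'. (- 1) ^ card S * series k (w + sum h S))"
        unfolding G'_def sum_distrib_left by (intro sum.cong) auto
      moreover have "0 \<le> (\<Sum>S\<in>Pow J'. (- 1) ^ card S * series k (w + sum h S))"
        using step.prems J fin w by (intro step.IH) auto
      ultimately show "\<exists>y. (G has_real_derivative y) (at w) \<and> y \<le> 0"
        by (intro exI[of _ G']) (simp add: mult_nonpos_nonneg)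
    qed
    moreover have "(\<Sum>S\<in>Pow J'. (- 1) ^ card (insert i S) * series (Suc k) (z + sum h (insert i S)))
        = - G (z + h i)"
      unfolding G_def sum_negf[symmetric]
    proof (rule sum.cong)
      fix S assume "S \<in> Pow J'"
      then have "finite S" "i \<notin> S" using fin J finite_subset by auto
      then show "(- 1) ^ card (insert i S) * series (Suc k) (z + sum h (insert i S))
          = - ((- 1) ^ card S * series (Suc k) (z + h i + sum h S))"
        by (simp add: add_ac)
    qed simp
    ultimately show ?thesis
      using J fin by (simp add: sum_Pow_insert G_def)
  qed
qed

text \<open>Splitting off the terms with \<open>a n = z\<close> leaves a series that is differentiable at \<open>z\<close>.\<close>

lemma series_1_not_DERIV:
  assumes "1 \<le> K" "a m = z" "0 < c m"
  shows "\<not> (series 1 has_real_derivative D) (at z)"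
proof
  assume deriv: "(series 1 has_real_derivative D) (at z)"
  \<comment> \<open>Several indices may share the kink \<open>z\<close>, so all of them are removed,
    not just \<open>m\<close>.\<close>
  define c' where "c' n = (if a n = z then 0 else c n)" for n
  define b where "b n = (if a n = z then c n else 0)" for n
  have "0 < z" using assms(2) a_pos by blast
  interpret rest: truncated_power_series a c' K
    by unfold_locales (use a_pos c_nonneg c_le in \<open>auto simp: c'_def less_imp_le\<close>)
  have "(rest.series (Suc 0) has_real_derivative - real (Suc 0) * rest.series 0 z) (at z)"
    using \<open>0 < z\<close> assms by (intro rest.DERIV_series) (auto simp: c'_def)
  with deriv have diff: "((\<lambda>w. series 1 w - rest.series 1 w) has_real_derivative
      D + rest.series 0 z) (at z)"
    by (auto intro!: derivative_eq_intros)
  have "summable b"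
    by (rule summable_comparison_test'[of "\<lambda>n. (1/2) ^ n" 0])
       (use c_power_le[of 0] c_nonneg in \<open>auto simp: b_def summable_geometric abs_of_nonneg\<close>)
  then have pos: "0 < suminf b"
    using assms c_nonneg by (intro suminf_pos2[of b m]) (auto simp: b_def)
  \<comment> \<open>The removed terms have the common factor
    \<open>truncated_power 1 (z - w)\<close> and collapse into one positive multiple of it.\<close>
  have "series 1 w - rest.series 1 w = suminf b * truncated_power 1 (z - w)" if "-1 < w" for w
  proof -
    have "series 1 w - rest.series 1 w =
        (\<Sum>n. c n * truncated_power 1 (a n - w) - c' n * truncated_power 1 (a n - w))"
      unfolding series_def rest.series_def using assms that
      by (intro suminf_diff summable_terms rest.summable_terms) auto
    also have "\<dots> = (\<Sum>n. b n * truncated_power 1 (z - w))"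
      by (intro suminf_cong) (simp add: b_def c'_def)
    also have "\<dots> = suminf b * truncated_power 1 (z - w)"
      using \<open>summable b\<close> by (rule suminf_mult2[symmetric])
    finally show ?thesis .
  qed
  with diff \<open>0 < z\<close> have "((\<lambda>w. suminf b * truncated_power 1 (z - w)) has_real_derivative
      D + rest.series 0 z) (at z)"
    by (intro has_field_derivative_transform_within_open[OF diff, of "{-1<..}"]) auto
  \<comment> \<open>Writing the point as \<open>z - 0\<close> prepares the substitution
    \<open>w = z - t\<close>, which moves the kink to 0.\<close>
  from DERIV_cdivide[OF this, of "suminf b"] pos
  have "((\<lambda>w. truncated_power 1 (z - w)) has_real_derivative
      (D + rest.series 0 z) / suminf b) (at (z - 0))"
    by simp
  then have "((\<lambda>t. truncated_power 1 (z - (z - t))) has_real_derivative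
      (D + rest.series 0 z) / suminf b * - 1) (at 0)"
    by (rule DERIV_chain2) (auto intro!: derivative_eq_intros)
  then have "(truncated_power 1 has_real_derivative
      (D + rest.series 0 z) / suminf b * - 1) (at 0)"
    by simp
  then show False
    using not_DERIV_truncated_power_1 by blast
qed

end

section \<open>Archimedean copulas of strict generators\<close>

definition archimedean :: "nat \<Rightarrow> (real \<Rightarrow> real) \<Rightarrow> (nat \<Rightarrow> real) \<Rightarrow> real" where
  "archimedean d \<psi> u = generator_ext \<psi> (\<Sum>i=1..d. pseudo_inverse \<psi> (u i))"

locale strict_generator =
  fixes \<psi> :: "real \<Rightarrow> real"
  assumes continuous: "continuous_on {0..} \<psi>"
    and strict_antimono: "strict_antimono_on {0..} \<psi>"
    and at_0: "\<psi> 0 = 1"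
    and pos: "\<And>z. 0 \<le> z \<Longrightarrow> 0 < \<psi> z"
    and tendsto_0: "(\<psi> \<longlongrightarrow> 0) at_top"
begin

lemma less: "0 \<le> z \<Longrightarrow> z < w \<Longrightarrow> \<psi> w < \<psi> z"
  using strict_antimono by (auto simp: monotone_on_def)

lemma antimono: "0 \<le> z \<Longrightarrow> z \<le> w \<Longrightarrow> \<psi> w \<le> \<psi> z"
  using less[of z w] by (cases "z = w") auto

lemma inj_on_atLeast: "inj_on \<psi> {0..}"
  by (rule inj_onI) (metis atLeast_iff less less_irrefl linorder_less_linear)

lemma generator: "generator \<psi>"
proof -
  have "{x. 0 \<le> x \<and> \<psi> x = 0} = {}"
    using pos by force
  moreover have "antimono_on {0..} \<psi>"
    by (auto simp: monotone_on_def intro: antimono)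
  moreover have "\<psi> \<in> {0..} \<rightarrow> {0..1}"
    using antimono[of 0] pos at_0 by (auto simp: less_imp_le)
  moreover have "strict_antimono_on {z. 0 \<le> z \<and> P z} \<psi>" for P
    using strict_antimono by (rule monotone_on_subset) auto
  ultimately show ?thesis
    using continuous at_0 tendsto_0 by (simp add: generator_def)
qed

lemma image_atLeast: "\<psi> ` {0..} = {0<..1}"
proof
  show "\<psi> ` {0..} \<subseteq> {0<..1}"
    using antimono[of 0] pos at_0 by auto
  show "{0<..1} \<subseteq> \<psi> ` {0..}"
  proof
    fix y :: real assume y: "y \<in> {0<..1}"
    then have "eventually (\<lambda>z. \<psi> z < y \<and> 0 \<le> z) at_top"
      using order_tendstoD(2)[OF tendsto_0] by (intro eventually_conj eventually_ge_at_top) auto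
    then obtain b where b: "\<psi> b < y" "0 \<le> b"
      by (auto dest: eventually_happens)
    then have "\<exists>z\<ge>0. z \<le> b \<and> \<psi> z = y"
      using y at_0 by (intro IVT2' continuous_on_subset[OF continuous]) auto
    then show "y \<in> \<psi> ` {0..}" by auto
  qed
qed

text \<open>The real-valued form of \<open>pseudo_inverse\<close> on (0, 1]. At 0, which \<psi>
  never attains, the value is arbitrary, so the coordinate 0 is always treated separately.\<close>

definition \<phi> :: "real \<Rightarrow> real" where
  "\<phi> = inv_into {0..} \<psi>"

lemma \<psi>_\<phi>: "0 < y \<Longrightarrow> y \<le> 1 \<Longrightarrow> \<psi> (\<phi> y) = y"
  unfolding \<phi>_def by (rule f_inv_into_f) (simp add: image_atLeast)

lemma \<phi>_nonneg: "0 < y \<Longrightarrow> y \<le> 1 \<Longrightarrow> 0 \<le> \<phi> y"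
  unfolding \<phi>_def using inv_into_into[of y \<psi> "{0..}"] by (simp add: image_atLeast)

lemma \<phi>_\<psi>: "0 \<le> z \<Longrightarrow> \<phi> (\<psi> z) = z"
  unfolding \<phi>_def by (rule inv_into_f_f[OF inj_on_atLeast]) simp

lemma \<phi>_1: "\<phi> 1 = 0"
  using \<phi>_\<psi>[of 0] at_0 by simp

lemma \<phi>_pos: "0 < y \<Longrightarrow> y < 1 \<Longrightarrow> 0 < \<phi> y"
  using \<phi>_nonneg[of y] \<psi>_\<phi>[of y] at_0 by (cases "\<phi> y = 0") auto

lemma \<phi>_antimono: "0 < y \<Longrightarrow> y \<le> y' \<Longrightarrow> y' \<le> 1 \<Longrightarrow> \<phi> y' \<le> \<phi> y"
  using less[of "\<phi> y" "\<phi> y'"] \<phi>_nonneg[of y] \<psi>_\<phi>[of y] \<psi>_\<phi>[of y'] by fastforce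

lemma pseudo_inverse_eq:
  assumes "0 < y" "y \<le> 1"
  shows "pseudo_inverse \<psi> y = ennreal (\<phi> y)"
proof -
  have "generator_ext \<psi> z = y \<longleftrightarrow> z = ennreal (\<phi> y)" for z
  proof (cases z)
    case (real r)
    then have "\<psi> r = y \<longleftrightarrow> r = \<phi> y"
      using assms \<psi>_\<phi> \<phi>_\<psi> by auto
    then show ?thesis
      using real assms \<phi>_nonneg by (simp add: generator_ext_def)
  qed (use assms in \<open>simp add: generator_ext_def\<close>)
  then show ?thesis by (simp add: pseudo_inverse_def)
qed

lemma pseudo_inverse_0: "pseudo_inverse \<psi> 0 = \<infinity>"
proof -
  have "{z. generator_ext \<psi> z = 0} = {\<infinity>}"
    using pos[OF enn2real_nonneg] by (auto simp: generator_ext_def less_le split: if_splits)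
  then show ?thesis by (simp add: pseudo_inverse_def)
qed

lemma archimedean_eq:
  assumes "\<And>i. i \<in> {1..d} \<Longrightarrow> 0 < u i \<and> u i \<le> 1"
  shows "archimedean d \<psi> u = \<psi> (\<Sum>i=1..d. \<phi> (u i))"
proof -
  have "(\<Sum>i=1..d. pseudo_inverse \<psi> (u i)) = (\<Sum>i=1..d. ennreal (\<phi> (u i)))"
    using assms by (intro sum.cong) (auto simp: pseudo_inverse_eq)
  also have "\<dots> = ennreal (\<Sum>i=1..d. \<phi> (u i))"
    using assms \<phi>_nonneg by (intro sum_ennreal) auto
  moreover have "0 \<le> (\<Sum>i=1..d. \<phi> (u i))"
    using assms \<phi>_nonneg by (intro sum_nonneg) auto
  ultimately show ?thesis
    by (simp add: archimedean_def generator_ext_def)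
qed

lemma archimedean_eq_0:
  assumes "i \<in> {1..d}" "u i = 0"
  shows "archimedean d \<psi> u = 0"
proof -
  have "(\<Sum>i=1..d. pseudo_inverse \<psi> (u i)) = \<infinity>"
    using assms by (auto simp: ennreal_sum_eq_top pseudo_inverse_0 intro!: bexI[of _ i])
  then show ?thesis by (simp add: archimedean_def generator_ext_def)
qed

text \<open>If a lower corner has vanishing coordinates, the terms of the \<open>C\<close>-volume that involve them
  vanish and only an alternating sum over fewer coordinates remains.\<close>

lemma copula_archimedean:
  assumes alternating: "\<And>(J :: nat set) h z. finite J \<Longrightarrow> card J \<le> d \<Longrightarrow> (\<And>i. i \<in> J \<Longrightarrow> 0 \<le> h i) \<Longrightarrow> 0 \<le> z \<Longrightarrow>
    0 \<le> (\<Sum>S\<in>Pow J. (- 1) ^ card S * \<psi> (z + sum h S))"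
  shows "copula d (archimedean d \<psi>)"
  unfolding copula_def
proof (intro conjI ballI impI)
  fix u :: "nat \<Rightarrow> real" assume "\<exists>i\<in>{1..d}. u i = 0"
  then show "archimedean d \<psi> u = 0"
    using archimedean_eq_0 by auto
next
  fix u i assume u: "u \<in> unit_cube {1..d}" "i \<in> {1..d}" "\<forall>j\<in>{1..d} - {i}. u j = 1"
  show "archimedean d \<psi> u = u i"
  proof (cases "u i = 0")
    case True
    then show ?thesis using archimedean_eq_0 u by auto
  next
    case False
    then have ui: "0 < u i" "u i \<le> 1"
      using PiE_mem[OF u(1)[unfolded unit_cube_def] u(2)] by auto
    have "archimedean d \<psi> u = \<psi> (\<Sum>j=1..d. \<phi> (u j))"
      using u ui by (intro archimedean_eq) (metis DiffI order_refl singletonD zero_less_one)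
    also have "(\<Sum>j=1..d. \<phi> (u j)) = \<phi> (u i) + (\<Sum>j\<in>{1..d} - {i}. \<phi> (u j))"
      using u by (intro sum.remove) auto
    also have "(\<Sum>j\<in>{1..d} - {i}. \<phi> (u j)) = 0"
      using u by (intro sum.neutral) (auto simp: \<phi>_1)
    finally show ?thesis using \<psi>_\<phi> ui by simp
  qed
next
  fix a b assume a: "a \<in> unit_cube {1..d}" and b: "b \<in> unit_cube {1..d}"
    and ab: "\<forall>i\<in>{1..d}. a i \<le> b i"
  let ?corner = "\<lambda>S i. if i \<in> S then a i else b i"
  have range: "0 \<le> a i" "a i \<le> b i" "b i \<le> 1" if "i \<in> {1..d}" for i
    using PiE_mem[OF a[unfolded unit_cube_def] that] PiE_mem[OF b[unfolded unit_cube_def] that] ab that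
    by auto
  show "0 \<le> (\<Sum>S\<in>Pow {1..d}. (- 1) ^ card S * archimedean d \<psi> (?corner S))"
  proof (cases "\<exists>i\<in>{1..d}. b i = 0")
    case True
    \<comment> \<open>Then \<open>a i = 0\<close> as well, so every corner has a vanishing
      coordinate.\<close>
    then obtain i where i: "i \<in> {1..d}" "b i = 0" "a i = 0"
      using range by force
    then have "archimedean d \<psi> (?corner S) = 0" for S
      by (intro archimedean_eq_0[of i]) auto
    then show ?thesis by simp
  next
    case False
    then have b_pos: "0 < b i" if "i \<in> {1..d}" for i
      using range that by force
    define J where "J = {i\<in>{1..d}. a i \<noteq> 0}"
    \<comment> \<open>\<open>z\<close> is the argument of \<psi> at the upper corner; passing to the
      lower corner in a coordinate \<open>i\<close> of \<open>J\<close> adds \<open>h i\<close>,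
      which is nonnegative because \<phi> is decreasing.\<close>
    define z where "z = (\<Sum>i=1..d. \<phi> (b i))"
    define h where "h i = \<phi> (a i) - \<phi> (b i)" for i
    have a_pos: "0 < a i" if "i \<in> J" for i
      using that range[of i] by (auto simp: J_def)
    have "(\<Sum>S\<in>Pow {1..d}. (- 1) ^ card S * archimedean d \<psi> (?corner S))
        = (\<Sum>S\<in>Pow J. (- 1) ^ card S * archimedean d \<psi> (?corner S))"
    proof (rule sum.mono_neutral_right)
      show "\<forall>S\<in>Pow {1..d} - Pow J. (- 1) ^ card S * archimedean d \<psi> (?corner S) = 0"
      proof
        fix S assume "S \<in> Pow {1..d} - Pow J"
        then obtain i where "i \<in> {1..d}" "i \<in> S" "i \<notin> J"
          by blast
        then show "(- 1) ^ card S * archimedean d \<psi> (?corner S) = 0"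
          using archimedean_eq_0[of i d "?corner S"] by (simp add: J_def)
      qed
    qed (auto simp: J_def)
    also have "\<dots> = (\<Sum>S\<in>Pow J. (- 1) ^ card S * \<psi> (z + sum h S))"
    proof (rule sum.cong)
      fix S assume S: "S \<in> Pow J"
      then have "S \<subseteq> {1..d}" by (auto simp: J_def)
      have "archimedean d \<psi> (?corner S) = \<psi> (\<Sum>i=1..d. \<phi> (?corner S i))"
        using S a_pos b_pos range by (intro archimedean_eq) (force simp: J_def)
      also have "(\<Sum>i=1..d. \<phi> (?corner S i)) = (\<Sum>i=1..d. \<phi> (b i) + (if i \<in> S then h i else 0))"
        by (intro sum.cong) (auto simp: h_def)
      also have "\<dots> = z + sum h S"
        using \<open>S \<subseteq> {1..d}\<close> by (simp add: sum.distrib z_def sum.inter_restrict[symmetric] Int_absorb1)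
      finally show "(- 1) ^ card S * archimedean d \<psi> (?corner S) = (- 1) ^ card S * \<psi> (z + sum h S)"
        by simp
    qed simp
    also have "0 \<le> \<dots>"
    proof (rule alternating)
      show "finite J" by (simp add: J_def)
      have "J \<subseteq> {1..d}"
        by (auto simp: J_def)
      from card_mono[OF _ this] show "card J \<le> d"
        by simp
      show "0 \<le> h i" if "i \<in> J" for i
        using that a_pos range \<phi>_antimono[of "a i" "b i"] by (auto simp: h_def J_def)
      show "0 \<le> z"
        unfolding z_def using b_pos range \<phi>_nonneg by (intro sum_nonneg) auto
    qed
    finally show ?thesis .
  qed
qed

end

section \<open>Nonexistence of mixed partial derivatives at kinks\<close>

text \<open>\<open>F k\<close> is the \<open>k\<close>-th derivative of the generator \<open>F 0\<close>. The set \<open>A\<close> consists of the kinks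
  of \<open>F (d - 2)\<close>; for \<open>d = 2\<close> the generator itself has them, so its derivative \<open>Q\<close> is only
  available off \<open>A\<close>.\<close>

locale kinked_generator = strict_generator "F 0"
  for F :: "nat \<Rightarrow> real \<Rightarrow> real" +
  fixes d :: nat and Q :: "real \<Rightarrow> real" and A :: "real set"
  assumes d_ge_2: "2 \<le> d"
    and DERIV_F: "\<And>k z. k < d - 2 \<Longrightarrow> 0 < z \<Longrightarrow> (F k has_real_derivative F (Suc k) z) (at z)"
    and DERIV_Q: "\<And>z. 0 < z \<Longrightarrow> z \<notin> A \<Longrightarrow> (F 0 has_real_derivative Q z) (at z)"
    and Q_nonzero: "\<And>z. 0 < z \<Longrightarrow> z \<notin> A \<Longrightarrow> Q z \<noteq> 0"
    and kink: "\<And>z D. z \<in> A \<Longrightarrow> \<not> (F (d - 2) has_real_derivative D) (at z)"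
    and countable_A: "countable A"
    and dense_A: "\<And>l r. 0 \<le> l \<Longrightarrow> l < r \<Longrightarrow> \<exists>z\<in>A. l < z \<and> z < r"
begin

text \<open>Differentiability of a function of \<open>\<phi> t\<close> at \<open>t\<close> is transferred to the variable \<open>z = \<phi> t\<close>
  by composing with \<open>F 0\<close>; thus the derivative of \<open>\<phi>\<close> is never needed.\<close>

lemma DERIV_reparametrize:
  assumes x: "0 < x" "x < 1" "\<phi> x \<notin> A"
    and deriv: "(g has_real_derivative D) (at x within {0..1})"
    and "e > 0"
    and g: "\<And>t. 0 < t \<Longrightarrow> t < 1 \<Longrightarrow> \<bar>t - x\<bar> < e \<Longrightarrow> g t = c * G (\<phi> t + s)"
  shows "((\<lambda>z. c * G z) has_real_derivative D * Q (\<phi> x)) (at (\<phi> x + s))"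
proof -
  have z: "0 < \<phi> x" "F 0 (\<phi> x) = x"
    using x \<phi>_pos \<psi>_\<phi> by auto
  have dQ: "(F 0 has_real_derivative Q (\<phi> x)) (at (\<phi> x))"
    using z x by (intro DERIV_Q) auto
  have "(g has_real_derivative D) (at (F 0 (\<phi> x)))"
    using deriv x z by (simp add: at_within_Icc_at)
  from DERIV_chain2[OF this dQ]
  have comp: "((\<lambda>z. g (F 0 z)) has_real_derivative D * Q (\<phi> x)) (at (\<phi> x))" .
  \<comment> \<open>Continuity keeps \<open>F 0 z\<close> in the range where the formula for
    \<open>g\<close> is available, and there \<open>\<phi> (F 0 z) = z\<close>.\<close>
  have "eventually (\<lambda>z. F 0 z \<in> {0<..<1} \<inter> {x - e<..<x + e}) (nhds (\<phi> x))"
  proof (rule topological_tendstoD)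
    show "(F 0 \<longlongrightarrow> x) (nhds (\<phi> x))"
      using DERIV_isCont[OF dQ] z(2) by (metis isCont_def tendsto_at_iff_tendsto_nhds)
  qed (use x \<open>e > 0\<close> in auto)
  moreover have "eventually (\<lambda>z. z \<in> {0<..}) (nhds (\<phi> x))"
    using z by (intro eventually_nhds_in_open) auto
  ultimately have ev: "eventually (\<lambda>z. g (F 0 z) = c * G (z + s)) (nhds (\<phi> x))"
    by eventually_elim (auto simp: g \<phi>_\<psi>)
  have "((\<lambda>z. c * G (z + s)) has_real_derivative D * Q (\<phi> x)) (at (\<phi> x))"
    using comp DERIV_cong_ev[OF refl ev refl] by simp
  then show ?thesis by (simp add: DERIV_shift)
qed

text \<open>This is only the uniqueness half of the formula for the mixed partial derivatives: existence
  is irrelevant for showing that a higher derivative does not exist.\<close>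

lemma mixed_partial_eq:
  assumes "has_mixed_partial ks (archimedean d (F 0)) u D"
    and "distinct ks" "set ks \<subseteq> {1..d}" "length ks \<le> d - 2"
    and "\<And>i. i \<in> {1..d} \<Longrightarrow> 0 < u i \<and> u i < 1"
    and "\<And>i. i \<in> set ks \<Longrightarrow> \<phi> (u i) \<notin> A"
  shows "D = F (length ks) (\<Sum>i=1..d. \<phi> (u i)) / (\<Prod>i\<in>set ks. Q (\<phi> (u i)))"
  using assms
proof (induction ks arbitrary: u D)
  case Nil
  then have "archimedean d (F 0) u = F 0 (\<Sum>i=1..d. \<phi> (u i))"
    by (intro archimedean_eq) (simp add: less_imp_le)
  then show ?case using Nil by simp
next
  case (Cons i ks)
  from Cons.prems(1)[unfolded has_mixed_partial.simps] obtain g e where "e > 0"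
    and g: "\<And>t. t \<in> {0..1} \<Longrightarrow> \<bar>t - u i\<bar> < e \<Longrightarrow>
      has_mixed_partial ks (archimedean d (F 0)) (u(i := t)) (g t)"
    and deriv: "(g has_real_derivative D) (at (u i) within {0..1})"
    by blast
  have i: "i \<in> {1..d}" "i \<notin> set ks" "0 < u i" "u i < 1" "\<phi> (u i) \<notin> A"
    using Cons.prems by auto
  define s where "s = (\<Sum>j\<in>{1..d} - {i}. \<phi> (u j))"
  define P where "P = (\<Prod>j\<in>set ks. Q (\<phi> (u j)))"
  have sum: "(\<Sum>j=1..d. \<phi> ((u(i := t)) j)) = \<phi> t + s" for t
    using i by (subst sum.remove[of _ i]) (auto simp: s_def intro!: sum.cong)
  have total: "(\<Sum>j=1..d. \<phi> (u j)) = \<phi> (u i) + s"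
    using sum[of "u i"] by simp
  \<comment> \<open>The induction hypothesis keeps only the coordinates in \<open>ks\<close> off the
    kinks and \<open>i\<close> is not among them, so \<open>t\<close> ranges over a full interval
    even where \<open>\<phi> t\<close> lies in \<open>A\<close>.\<close>
  have "g t = inverse P * F (length ks) (\<phi> t + s)" if "0 < t" "t < 1" "\<bar>t - u i\<bar> < e" for t
  proof -
    have "g t = F (length ks) (\<Sum>j=1..d. \<phi> ((u(i := t)) j)) / (\<Prod>j\<in>set ks. Q (\<phi> ((u(i := t)) j)))"
      using that Cons.prems i by (intro Cons.IH g) auto
    also have "(\<Prod>j\<in>set ks. Q (\<phi> ((u(i := t)) j))) = P"
      unfolding P_def using i by (intro prod.cong) auto
    finally show ?thesis unfolding sum by (simp add: field_simps)
  qed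
  from DERIV_reparametrize[OF i(3-5) deriv \<open>e > 0\<close> this]
  have "((\<lambda>z. inverse P * F (length ks) z) has_real_derivative D * Q (\<phi> (u i))) (at (\<phi> (u i) + s))" .
  moreover have "0 < \<phi> (u i) + s"
    unfolding s_def using i Cons.prems(5) \<phi>_nonneg
    by (intro add_pos_nonneg \<phi>_pos sum_nonneg) (auto simp: less_imp_le)
  \<comment> \<open>Here \<open>length ks < d - 2\<close>, so this order is differentiable at every
    positive point, whether in \<open>A\<close> or not.\<close>
  then have "((\<lambda>z. inverse P * F (length ks) z) has_real_derivative
      inverse P * F (Suc (length ks)) (\<phi> (u i) + s)) (at (\<phi> (u i) + s))"
    using Cons.prems by (intro DERIV_cmult DERIV_F) auto
  ultimately have "D * Q (\<phi> (u i)) = inverse P * F (Suc (length ks)) (\<phi> (u i) + s)"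
    by (rule DERIV_unique)
  moreover have "Q (\<phi> (u i)) \<noteq> 0"
    using i by (intro Q_nonzero \<phi>_pos) auto
  ultimately have "D = inverse P * F (Suc (length ks)) (\<phi> (u i) + s) / Q (\<phi> (u i))"
    by (simp add: nonzero_eq_divide_eq)
  then show ?case
    using i unfolding total by (simp add: P_def[symmetric] divide_inverse mult_ac)
qed

text \<open>Without the outermost derivative, \<open>mixed_partial_eq\<close> leaves a nonzero
  multiple of \<open>F (d - 2)\<close> at the sum. One more derivative would carry over to
  \<open>F (d - 2)\<close> at a point of \<open>A\<close>, contradicting
  \<open>kink\<close>.\<close>

lemma no_mixed_partial:
  assumes "distinct ks" "set ks \<subseteq> {1..d}" "length ks = d - 1"
    and u: "\<And>i. i \<in> {1..d} \<Longrightarrow> 0 < u i \<and> u i < 1"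
    and off: "\<And>i. i \<in> set ks \<Longrightarrow> \<phi> (u i) \<notin> A"
    and on: "(\<Sum>i=1..d. \<phi> (u i)) \<in> A"
  shows "\<not> has_mixed_partial ks (archimedean d (F 0)) u D"
proof
  assume has: "has_mixed_partial ks (archimedean d (F 0)) u D"
  obtain i ks' where ks: "ks = i # ks'"
    using assms(3) d_ge_2 by (cases ks) auto
  from has[unfolded ks has_mixed_partial.simps] obtain g e where "e > 0"
    and g: "\<And>t. t \<in> {0..1} \<Longrightarrow> \<bar>t - u i\<bar> < e \<Longrightarrow>
      has_mixed_partial ks' (archimedean d (F 0)) (u(i := t)) (g t)"
    and deriv: "(g has_real_derivative D) (at (u i) within {0..1})"
    by blast
  have i: "i \<in> {1..d}" "i \<notin> set ks'" "0 < u i" "u i < 1" "\<phi> (u i) \<notin> A"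
    using assms ks by auto
  have len: "length ks' = d - 2" using assms ks by simp
  define s where "s = (\<Sum>j\<in>{1..d} - {i}. \<phi> (u j))"
  define P where "P = (\<Prod>j\<in>set ks'. Q (\<phi> (u j)))"
  have "P \<noteq> 0"
    unfolding P_def using assms ks Q_nonzero \<phi>_pos by (auto simp: subset_eq)
  have sum: "(\<Sum>j=1..d. \<phi> ((u(i := t)) j)) = \<phi> t + s" for t
    using i by (subst sum.remove[of _ i]) (auto simp: s_def intro!: sum.cong)
  have total: "(\<Sum>j=1..d. \<phi> (u j)) = \<phi> (u i) + s"
    using sum[of "u i"] by simp
  have "g t = inverse P * F (d - 2) (\<phi> t + s)" if "0 < t" "t < 1" "\<bar>t - u i\<bar> < e" for t
  proof -
    have "g t = F (length ks') (\<Sum>j=1..d. \<phi> ((u(i := t)) j)) / (\<Prod>j\<in>set ks'. Q (\<phi> ((u(i := t)) j)))"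
      using that assms ks i by (intro mixed_partial_eq g) auto
    also have "(\<Prod>j\<in>set ks'. Q (\<phi> ((u(i := t)) j))) = P"
      unfolding P_def using i by (intro prod.cong) auto
    finally show ?thesis unfolding sum len by (simp add: field_simps)
  qed
  from DERIV_reparametrize[OF i(3-5) deriv \<open>e > 0\<close> this]
  have "((\<lambda>z. inverse P * F (d - 2) z) has_real_derivative D * Q (\<phi> (u i))) (at (\<phi> (u i) + s))" .
  from DERIV_cmult[OF this, of P]
  have "(F (d - 2) has_real_derivative P * (D * Q (\<phi> (u i)))) (at (\<phi> (u i) + s))"
    using \<open>P \<noteq> 0\<close> by (simp add: mult.assoc[symmetric])
  then show False
    using kink on unfolding total by blast
qed

text \<open>Density of \<open>A\<close> and continuity of \<open>F 0\<close> move any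
  \<open>y\<close> slightly so that the sum lands in \<open>A\<close>. Coordinate \<open>d\<close>
  is not in \<open>ks\<close>, so the image of the new \<open>y\<close> under \<phi> may itself be a
  kink.\<close>

lemma dense_no_mixed_partial:
  assumes ks: "distinct ks" "set ks \<subseteq> {1..<d}" "length ks = d - 1"
    and x: "\<And>i. i \<in> {1..<d} \<Longrightarrow> 0 < x i \<and> x i < 1 \<and> \<phi> (x i) \<notin> A"
  shows "{0..1} \<subseteq> closure {y\<in>{0..1}. \<nexists>D. has_mixed_partial ks (archimedean d (F 0)) (x(d := y)) D}"
    (is "_ \<subseteq> closure ?N")
proof -
  define s where "s = (\<Sum>i\<in>{1..<d}. \<phi> (x i))"
  have "0 \<le> s"
    unfolding s_def using x \<phi>_nonneg by (intro sum_nonneg) (auto simp: less_imp_le)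
  have "{0<..<1} \<subseteq> closure ?N"
  proof
    fix y :: real assume y: "y \<in> {0<..<1}"
    show "y \<in> closure ?N"
      unfolding closure_iff_nhds_not_empty
    proof (intro allI impI)
      fix B V assume V: "V \<subseteq> B" "open V" "y \<in> V"
      have "continuous_on {0<..} (F 0)"
        using continuous by (rule continuous_on_subset) auto
      then have "open (F 0 -` V \<inter> {0<..})"
        using V by (simp add: continuous_on_open_vimage)
      moreover have "\<phi> y \<in> F 0 -` V \<inter> {0<..}"
        using y V by (auto simp: \<psi>_\<phi> \<phi>_pos)
      ultimately obtain e where e: "0 < e" "\<And>z. \<bar>z - \<phi> y\<bar> < e \<Longrightarrow> F 0 z \<in> V \<and> 0 < z"
        unfolding open_dist by (auto simp: dist_real_def)
      have "0 < \<phi> y"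
        using y \<phi>_pos by auto
      then have "0 \<le> s + \<phi> y" "s + \<phi> y < s + \<phi> y + e"
        using \<open>0 \<le> s\<close> e(1) by auto
      from dense_A[OF this] obtain a where a: "a \<in> A" "s + \<phi> y < a" "a < s + \<phi> y + e"
        by auto
      \<comment> \<open>Solves \<open>s + \<phi> y' = a\<close>; since \<open>a - s\<close> is
        within \<open>e\<close> of \<open>\<phi> y\<close>, the point \<open>y'\<close> stays in
        \<open>V\<close>.\<close>
      define y' where "y' = F 0 (a - s)"
      have as: "0 < a - s" "y' \<in> V"
        using e(2)[of "a - s"] a by (auto simp: y'_def)
      have y': "0 < y'" "y' < 1"
        using pos[of "a - s"] less[of 0 "a - s"] at_0 as by (auto simp: y'_def)
      have d: "{1..d} = insert d {1..<d}"
        using d_ge_2 by auto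
      have "(\<Sum>i=1..d. \<phi> ((x(d := y')) i)) = \<phi> y' + (\<Sum>i\<in>{1..<d}. \<phi> (x i))"
        unfolding d by (subst sum.insert) (auto intro!: sum.cong)
      also have "\<dots> = a"
        using as by (simp add: y'_def \<phi>_\<psi> s_def)
      finally have "(\<Sum>i=1..d. \<phi> ((x(d := y')) i)) \<in> A"
        using a by simp
      then have "\<not> has_mixed_partial ks (archimedean d (F 0)) (x(d := y')) D" for D
        using ks x y' by (intro no_mixed_partial) (auto simp: subset_eq)
      then have "y' \<in> ?N"
        using y' by auto
      then show "?N \<inter> B \<noteq> {}"
        using as V by auto
    qed
  qed
  \<comment> \<open>The endpoints are recovered as limits of interior points.\<close>
  then have "closure {0<..<1} \<subseteq> closure ?N"
    by (intro closure_minimal) auto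
  then show ?thesis
    by simp
qed

text \<open>Countability of \<open>A\<close> makes the values excluded in each coordinate a null
  set, so every factor of the product still has measure 1.\<close>

lemma full_measure_off_kinks:
  defines "\<Lambda> \<equiv> {1..<d} \<rightarrow>\<^sub>E ({0<..<1} - F 0 ` A)"
  shows "\<Lambda> \<in> sets (Pi\<^sub>M {1..<d} (\<lambda>_. lborel))"
    and "emeasure (Pi\<^sub>M {1..<d} (\<lambda>_. lborel)) \<Lambda> = 1"
proof -
  interpret product_sigma_finite "\<lambda>_::nat. lborel :: real measure" ..
  have null: "F 0 ` A \<in> null_sets lborel"
    using countable_A by (intro countable_imp_null_set_lborel) auto
  then have sets: "{0<..<1} - F 0 ` A \<in> sets lborel"
    by (auto dest: null_setsD2)
  then show "\<Lambda> \<in> sets (Pi\<^sub>M {1..<d} (\<lambda>_. lborel))"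
    unfolding \<Lambda>_def by (intro sets_PiM_I_finite) auto
  have "emeasure lborel ({0<..<1} - F 0 ` A) = emeasure lborel {0<..<1::real}"
    using null by (intro emeasure_Diff_null_set) auto
  then show "emeasure (Pi\<^sub>M {1..<d} (\<lambda>_. lborel)) \<Lambda> = 1"
    unfolding \<Lambda>_def using sets by (subst emeasure_PiM) auto
qed

end

section \<open>A generator with kinks at all positive rationals\<close>

definition pos_rat :: "nat \<Rightarrow> real" where
  "pos_rat = from_nat_into (\<rat> \<inter> {0<..})"

lemma range_pos_rat: "range pos_rat = \<rat> \<inter> {0<..}"
proof -
  have "1 \<in> \<rat> \<inter> {0::real<..}" by simp
  then have "\<rat> \<inter> {0::real<..} \<noteq> {}" by blast
  then show ?thesis
    unfolding pos_rat_def by (intro range_from_nat_into) (auto intro: countable_Int1 countable_rat)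
qed

text \<open>The largest weights that \<open>truncated_power_series\<close> allows; being positive,
  they give \<open>series 1\<close> a kink at every positive rational.\<close>

definition weight :: "nat \<Rightarrow> nat \<Rightarrow> real" where
  "weight K n = (1/2) ^ n / (1 + pos_rat n) ^ K"

lemma exists_kinked_generator:
  assumes "2 \<le> d"
  shows "\<exists>F Q A. kinked_generator F d Q A \<and> copula d (archimedean d (F 0))"
proof -
  define K where "K = d - 1"
  have K: "1 \<le> K" "d = Suc K" using assms by (auto simp: K_def)
  have pos_rat: "0 < pos_rat n" for n
    using range_pos_rat by auto
  have w_pos: "0 < weight K n" for n
    using pos_rat[of n] by (simp add: weight_def)
  interpret truncated_power_series pos_rat "weight K" K
    by unfold_locales (use pos_rat w_pos in \<open>auto simp: less_imp_le weight_def\<close>)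
  \<comment> \<open>\<open>N\<close> normalizes the generator to 1 at 0, and \<open>q k\<close>
    collects the factors \<open>- K\<close>, \<open>- (K - 1)\<close>, ... produced by
    \<open>k\<close> differentiations.\<close>
  define N where "N = series K 0"
  define q where "q k = (\<Prod>j<k. - real (K - j)) / N" for k
  define F where "F k z = q k * series (K - k) z" for k z
  \<comment> \<open>For \<open>d = 2\<close> this is a multiple of \<open>series 0\<close>, a sum of
    step functions, and is the derivative only off the kinks.\<close>
  define Q where "Q z = q 1 * series (K - 1) z" for z
  have between: "\<exists>n. l < pos_rat n \<and> pos_rat n < r" if "0 \<le> l" "l < r" for l r
  proof -
    obtain z where "z \<in> \<rat>" "l < z" "z < r"
      using Rats_dense_in_real[OF \<open>l < r\<close>] by auto
    then have "z \<in> range pos_rat"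
      unfolding range_pos_rat using \<open>0 \<le> l\<close> by simp
    then show ?thesis using \<open>l < z\<close> \<open>z < r\<close> by auto
  qed
  have series_pos': "0 < series k z" if "k \<le> K" "0 \<le> z" for k z
  proof -
    obtain n where "z < pos_rat n"
      using between[of z "z + 1"] \<open>0 \<le> z\<close> by auto
    then show ?thesis using that w_pos[of n] by (intro series_pos) auto
  qed
  have N: "0 < N"
    unfolding N_def using series_pos' by simp
  have q0: "q 0 = 1 / N" by (simp add: q_def)
  have q_nz: "q k \<noteq> 0" if "k \<le> K" for k
    using that N by (auto simp: q_def)
  have DERIV: "((\<lambda>z. q k * series (K - k) z) has_real_derivative q (Suc k) * series (K - Suc k) z) (at z)"
    if "k < K" "0 < z" "K - k \<ge> 2 \<or> z \<notin> range pos_rat" for k z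
  proof -
    obtain m where m: "K - k = Suc m" "K - Suc k = m"
      using Suc_diff_Suc[OF \<open>k < K\<close>] by metis
    have "(series (Suc m) has_real_derivative - real (Suc m) * series m z) (at z)"
      using that m by (intro DERIV_series) auto
    from DERIV_cmult[OF this, of "q k"] show ?thesis
      by (simp add: m q_def mult.assoc)
  qed
  have F0: "F 0 = (\<lambda>z. series K z / N)"
    by (simp add: F_def q0 fun_eq_iff)
  have "kinked_generator F d Q (range pos_rat)"
  proof
    show "continuous_on {0..} (F 0)"
      unfolding F0 using K N by (intro continuous_intros continuous_on_subset[OF continuous_on_series]) auto
    show "strict_antimono_on {0..} (F 0)"
    proof (rule monotone_onI)
      fix z w :: real assume "z \<in> {0..}" "w \<in> {0..}" "z < w"
      moreover obtain n where "z < pos_rat n"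
        using between[of z w] calculation by auto
      ultimately show "F 0 w < F 0 z"
        unfolding F0 using K N w_pos[of n]
        by (intro divide_strict_right_mono series_strict_antimono[where n = n]) auto
    qed
    show "F 0 0 = 1"
      using N by (simp add: F0 N_def)
    show "0 < F 0 z" if "0 \<le> z" for z
      using that N series_pos' by (simp add: F0)
    show "(F 0 \<longlongrightarrow> 0) at_top"
      unfolding F0 using tendsto_divide[OF series_tendsto_0 tendsto_const, of K N] N by simp
    show "(F k has_real_derivative F (Suc k) z) (at z)" if "k < d - 2" "0 < z" for k z
      unfolding F_def using that K by (intro DERIV) auto
    show "(F 0 has_real_derivative Q z) (at z)" if "0 < z" "z \<notin> range pos_rat" for z
      unfolding F_def Q_def using that K DERIV[of 0 z] by simp
    show "Q z \<noteq> 0" if "0 < z" "z \<notin> range pos_rat" for z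
      unfolding Q_def using that K q_nz[of 1] series_pos'[of "K - 1" z] by simp
    show "\<not> (F (d - 2) has_real_derivative D) (at z)" if "z \<in> range pos_rat" for z D
    proof
      assume "(F (d - 2) has_real_derivative D) (at z)"
      \<comment> \<open>Since \<open>K - (d - 2) = 1\<close>, \<open>F (d - 2)\<close> is a nonzero
        multiple of \<open>series 1\<close>.\<close>
      from DERIV_cmult[OF this, of "inverse (q (d - 2))"]
      have "((\<lambda>z. inverse (q (d - 2)) * (q (d - 2) * series 1 z)) has_real_derivative
          inverse (q (d - 2)) * D) (at z)"
        using K by (simp add: F_def[abs_def])
      then have "(series 1 has_real_derivative inverse (q (d - 2)) * D) (at z)"
        using q_nz[of "d - 2"] K by (simp add: mult.assoc[symmetric])
      moreover obtain m where "pos_rat m = z"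
        using \<open>z \<in> range pos_rat\<close> by auto
      ultimately show False
        using series_1_not_DERIV[OF K(1) _ w_pos] by simp
    qed
    show "\<exists>z\<in>range pos_rat. l < z \<and> z < r" if "0 \<le> l" "l < r" for l r
      using between[OF that] by simp
  qed (use assms in simp_all)
  moreover from this interpret kinked_generator F d Q "range pos_rat" .
  have "copula d (archimedean d (F 0))"
  proof (rule copula_archimedean)
    fix J :: "nat set" and h :: "nat \<Rightarrow> real" and z :: real
    assume *: "finite J" "card J \<le> d" "\<And>i. i \<in> J \<Longrightarrow> 0 \<le> h i" "0 \<le> z"
    then have "0 \<le> (\<Sum>S\<in>Pow J. (- 1) ^ card S * series K (z + sum h S)) / N"
      using K N by (intro divide_nonneg_pos series_alternating_sum_nonneg) auto
    then show "0 \<le> (\<Sum>S\<in>Pow J. (- 1) ^ card S * F 0 (z + sum h S))"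
      by (simp add: F0 sum_divide_distrib)
  qed
  ultimately show ?thesis by blast
qed

theorem theorem5p2:
  fixes d :: nat
  assumes "d \<ge> 2"
  shows "\<exists>C. archimedean_copula d C \<and>
    (\<forall>\<pi>. \<pi> permutes {1..<d} \<longrightarrow>
      (\<exists>\<Lambda>\<in>sets (Pi\<^sub>M {1..<d} (\<lambda>_. lborel)).
         \<Lambda> \<subseteq> unit_cube {1..<d} \<and>
         emeasure (Pi\<^sub>M {1..<d} (\<lambda>_. lborel)) \<Lambda> = 1 \<and>
         (\<forall>x\<in>\<Lambda>. {0..1} \<subseteq> closure
            {y\<in>{0..1}. \<nexists>D. has_mixed_partial (map \<pi> [1..<d]) C (x(d := y)) D})))"
proof -
  obtain F Q A where kinked: "kinked_generator F d Q A" and copula: "copula d (archimedean d (F 0))"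
    using exists_kinked_generator[OF assms] by blast
  interpret kinked_generator F d Q A by (rule kinked)
  \<comment> \<open>One set serves all permutations, since the same values are excluded in every
    coordinate.\<close>
  define \<Lambda> where "\<Lambda> = {1..<d} \<rightarrow>\<^sub>E ({0<..<1} - F 0 ` A)"
  have "archimedean_copula d (archimedean d (F 0))"
    unfolding archimedean_copula_def
    using copula generator by (intro conjI exI[of _ "F 0"]) (simp_all add: archimedean_def)
  moreover have "\<Lambda> \<subseteq> unit_cube {1..<d}"
    unfolding \<Lambda>_def unit_cube_def by (intro PiE_mono) auto
  moreover have "{0..1} \<subseteq> closure
      {y\<in>{0..1}. \<nexists>D. has_mixed_partial (map \<pi> [1..<d]) (archimedean d (F 0)) (x(d := y)) D}"
    if "\<pi> permutes {1..<d}" "x \<in> \<Lambda>" for \<pi> x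
  proof (rule dense_no_mixed_partial)
    show "distinct (map \<pi> [1..<d])"
      using permutes_inj_on[OF that(1)] by (simp add: distinct_map)
    show "set (map \<pi> [1..<d]) \<subseteq> {1..<d}"
      using permutes_image[OF that(1)] by (simp only: set_map set_upt)
    fix i assume "i \<in> {1..<d}"
    then have "x i \<in> {0<..<1} - F 0 ` A"
      using that(2) unfolding \<Lambda>_def by (rule PiE_mem[rotated])
    then have x: "0 < x i" "x i < 1" "x i \<notin> F 0 ` A"
      by auto
    moreover have "F 0 (\<phi> (x i)) = x i"
      using x by (intro \<psi>_\<phi>) auto
    ultimately show "0 < x i \<and> x i < 1 \<and> \<phi> (x i) \<notin> A"
      by (metis imageI)
  qed simp
  ultimately show ?thesis
    using full_measure_off_kinks[folded \<Lambda>_def]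
    by (intro exI[of _ "archimedean d (F 0)"] conjI allI impI bexI[of _ \<Lambda>] ballI)
qed

end
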